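(* Let $1\le\mathbf{a}<\mathbf{b}$ be two co-prime integers, $k$ a positive integer, and $\widetilde S$ the sumset semigroup generated by $\{0,k\mathbf{a}\}$ and $\{0,k\mathbf{b}\}$, with ideal $I_{\widetilde S}\subset\mathbf{k}[x,y]$ ($x$ corresponding to $\{0,k\mathbf{a}\}$, $y$ to $\{0,k\mathbf{b}\}$). Then $I_{\widetilde S}$ is the principal ideal generated by $x^{\mathbf{b}-1}y^{\mathbf{a}-1}(x^{\mathbf{b}}-y^{\mathbf{a}})$.
   Context: For finite non-empty $A,B\subset\mathbb{N}$, $A+B=\{a+b\mid a\in A,b\in B\}$, and $\alpha\otimes A$ is the $\alpha$-fold sum of $A$ with itself ($0\otimes A=\{0\}$). The ideal of the sumset semigroup generated by $A_1,A_2$ is the binomial ideal $I\subset\mathbf{k}[x,y]$ ($\mathbf{k}$ a field) generated by all $x^{\alpha_1}y^{\alpha_2}-x^{\beta_1}y^{\beta_2}$ with $\alpha_1\otimes A_1+\alpha_2\otimes A_2=\beta_1\otimes A_1+\beta_2\otimes A_2$. *)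

theory Defs
  imports "HOL-Computational_Algebra.Polynomial" "HOL-Library.Set_Algebras"
begin

(* k[x,y] is rendered as k[x][y], i.e. the type 'k poly poly: x is the variable of the
   inner polynomial ring, y that of the outer one. *)

definition varX :: "'k::field poly poly" where
  "varX = [:[:0, 1:]:]"

definition varY :: "'k::field poly poly" where
  "varY = [:0, 1:]"

(* The ideal generated by G: the linear span of G when the ring is viewed as a module
   over itself, i.e. all finite combinations of elements of G with ring coefficients. *)

definition ideal_gen :: "'a::comm_ring_1 set \<Rightarrow> 'a set" where
  "ideal_gen G = module.span (*) G"

lemma module_self: "module ((*) :: 'a::comm_ring_1 \<Rightarrow> 'a \<Rightarrow> 'a)"
  by unfold_locales (simp_all add: algebra_simps)

(* The sum A + B of sets is the elementwise one of Set_Algebras. *)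

primrec fold_sum :: "nat \<Rightarrow> nat set \<Rightarrow> nat set" where
  "fold_sum 0 A = {0}"
| "fold_sum (Suc n) A = A + fold_sum n A"

definition sumset_ideal :: "nat set \<Rightarrow> nat set \<Rightarrow> 'k::field poly poly set" where
  "sumset_ideal A1 A2 = ideal_gen
     {varX ^ \<alpha>1 * varY ^ \<alpha>2 - varX ^ \<beta>1 * varY ^ \<beta>2 | \<alpha>1 \<alpha>2 \<beta>1 \<beta>2.
        fold_sum \<alpha>1 A1 + fold_sum \<alpha>2 A2 = fold_sum \<beta>1 A1 + fold_sum \<beta>2 A2}"

end

(* The set belonging to x^m y^n is {k(ia + jb) | i <= m, j <= n}. If (m, n) and (m', n') with m < m'
   give the same set, comparing maxima yields m' = m + bt and n = n' + at with t > 0; moreover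
   (m + 1)a and (n' + 1)b have to be representable with smaller coefficients, which forces
   m >= b - 1 and n' >= a - 1. So every defining binomial is a multiple of the generator. *)
theory Submission
  imports Defs
begin

lemma ideal_gen_singleton: "ideal_gen {g} = {p. g dvd p}"
proof -
  interpret module "(*) :: 'a \<Rightarrow> 'a \<Rightarrow> 'a" by (rule module_self)
  show ?thesis unfolding ideal_gen_def span_singleton by (auto simp: dvd_def mult.commute)
qed

text \<open>This splits the theorem into two tasks: \<open>g\<close> is itself one of the defining
  binomials, and \<open>g\<close> divides all the others.\<close>

lemma ideal_gen_eq_singleton:
  assumes "g \<in> G" and "\<And>p. p \<in> G \<Longrightarrow> g dvd p"
  shows "ideal_gen G = ideal_gen {g}"
proof -
  interpret module "(*) :: 'a \<Rightarrow> 'a \<Rightarrow> 'a" by (rule module_self)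
  have "G \<subseteq> ideal_gen {g}"
    using assms(2) by (auto simp: ideal_gen_singleton)
  then have "ideal_gen G \<subseteq> ideal_gen {g}"
    unfolding ideal_gen_def by (simp add: span_minimal)
  moreover have "ideal_gen {g} \<subseteq> ideal_gen G"
    unfolding ideal_gen_def using assms(1) by (intro span_mono) simp
  ultimately show ?thesis by blast
qed

lemma fold_sum_pair: "fold_sum n {0, c} = {i * c | i. i \<le> n}"
proof (induction n)
  case (Suc n)
  show ?case
  proof (intro set_eqI iffI)
    fix z assume "z \<in> fold_sum (Suc n) {0, c}"
    then obtain i where "i \<le> n" "z = i * c \<or> z = Suc i * c"
      by (auto simp: Suc.IH set_plus_def)
    then show "z \<in> {i * c | i. i \<le> Suc n}"
      by (auto intro: exI[of _ i] exI[of _ "Suc i"])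
  next
    fix z assume "z \<in> {i * c | i. i \<le> Suc n}"
    then obtain i where i: "i \<le> Suc n" "z = i * c" by blast
    show "z \<in> fold_sum (Suc n) {0, c}"
    proof (cases i)
      case 0
      then show ?thesis using i by (force simp: Suc.IH set_plus_def)
    next
      case (Suc j)
      then show ?thesis using i by (force simp: Suc.IH set_plus_def)
    qed
  qed
qed simp

text \<open>The sumset attached to x^m y^n with the common factor \<open>k\<close> divided out. As
  multiplication by a positive \<open>k\<close> is injective, \<open>k\<close> disappears from all
  comparisons.\<close>

definition box_values :: "nat \<Rightarrow> nat \<Rightarrow> nat \<Rightarrow> nat \<Rightarrow> nat set" where
  "box_values a b m n = {i * a + j * b | i j. i \<le> m \<and> j \<le> n}"

lemma fold_sum_plus_fold_sum:
  "fold_sum m {0, k * a} + fold_sum n {0, k * b} = (*) k ` box_values a b m n"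
proof -
  have "fold_sum m {0, k * a} + fold_sum n {0, k * b}
          = {k * (i * a + j * b) | i j. i \<le> m \<and> j \<le> n}"
    unfolding fold_sum_pair set_plus_def distrib_left mult.left_commute[of k] by blast
  also have "\<dots> = (*) k ` box_values a b m n"
    unfolding box_values_def by blast
  finally show ?thesis .
qed

lemma fold_sum_plus_eq_iff:
  assumes "0 < k"
  shows "fold_sum m {0, k * a} + fold_sum n {0, k * b} = fold_sum m' {0, k * a} + fold_sum n' {0, k * b}
           \<longleftrightarrow> box_values a b m n = box_values a b m' n'"
proof -
  have "inj ((*) k)" using assms by (simp add: inj_on_def)
  then show ?thesis by (simp add: fold_sum_plus_fold_sum inj_image_eq_iff)
qed

lemma box_values_swap: "box_values a b m n = box_values b a n m"
  unfolding box_values_def by (intro Collect_cong) (metis add.commute)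

lemma box_values_le:
  assumes "z \<in> box_values a b m n" shows "z \<le> m * a + n * b"
  using assms unfolding box_values_def by (auto intro!: add_mono)

lemma box_values_corner: "m * a + n * b \<in> box_values a b m n"
  unfolding box_values_def by blast

text \<open>Both sides are linked by the trade b * a = a * b: \<open>b\<close> copies of
  \<open>a\<close> are worth \<open>a\<close> copies of \<open>b\<close>.\<close>

lemma box_values_generator:
  "box_values a b (b - 1 + b) (a - 1) = box_values a b (b - 1) (a - 1 + a)"
proof -
  have subset: "box_values a b (b - 1 + b) (a - 1) \<subseteq> box_values a b (b - 1) (a - 1 + a)" for a b
  proof
    fix z assume "z \<in> box_values a b (b - 1 + b) (a - 1)"
    then obtain i j where ij: "z = i * a + j * b" "i \<le> b - 1 + b" "j \<le> a - 1"
      unfolding box_values_def by blast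
    show "z \<in> box_values a b (b - 1) (a - 1 + a)"
    proof (cases "i \<le> b - 1")
      case True
      then show ?thesis using ij unfolding box_values_def
        by (intro CollectI exI[of _ i] exI[of _ j]) simp
    next
      \<comment> \<open>One trade suffices: it leaves at most b - 1 copies of \<open>a\<close> and
        raises \<open>j\<close> to at most a - 1 + a.\<close>
      case False
      then have "b \<le> i" by linarith
      then obtain l where l: "i = b + l" using le_Suc_ex by blast
      then have "z = l * a + (j + a) * b" "l \<le> b - 1" "j + a \<le> a - 1 + a"
        using ij by (auto simp: algebra_simps)
      then show ?thesis unfolding box_values_def by blast
    qed
  qed
  show ?thesis using subset[of a b] subset[of b a] box_values_swap by blast
qed

lemma box_values_bound:
  assumes "coprime a b" and "m < m'" and "box_values a b m n = box_values a b m' n'"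
  shows "b - 1 \<le> m"
proof -
  \<comment> \<open>The smallest multiple of \<open>a\<close> whose obvious representation exceeds
    the first box; equality of the sets provides another one with i \<le> m.\<close>
  have "Suc m * a + 0 * b \<in> box_values a b m' n'"
    using assms(2) unfolding box_values_def by (intro CollectI exI[of _ "Suc m"] exI[of _ 0]) simp
  then obtain i j where ij: "Suc m * a = i * a + j * b" "i \<le> m"
    unfolding assms(3)[symmetric] unfolding box_values_def by auto
  have "(Suc m - i) * a = j * b"
    using ij by (simp add: diff_mult_distrib)
  then have "b dvd (Suc m - i) * a" by simp
  then have "b dvd Suc m - i"
    using assms(1) by (simp add: coprime_commute coprime_dvd_mult_left_iff)
  \<comment> \<open>The difference is positive because i \<le> m, so being a multiple of
    \<open>b\<close> makes it at least \<open>b\<close>.\<close>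
  then have "b \<le> Suc m - i" using ij by (intro dvd_imp_le) auto
  then show ?thesis by linarith
qed

lemma box_values_eqD:
  assumes "coprime a b" and "0 < a" and "0 < b" and "m < m'"
    and eq: "box_values a b m n = box_values a b m' n'"
  obtains t where "m' = m + b * t" "n = n' + a * t" "b - 1 \<le> m" "a - 1 \<le> n'"
proof -
  \<comment> \<open>The corner of a box gives the maximum of its set.\<close>
  have max: "m * a + n * b = m' * a + n' * b"
    using box_values_le box_values_corner eq by (metis le_antisym)
  obtain d where d: "m' = m + d" "0 < d"
    using assms(4) less_imp_add_positive by blast
  have nb: "n * b = n' * b + d * a" using max d by (simp add: algebra_simps)
  then have "n' * b < n * b" using d assms(2) by simp
  then have "n' < n" by simp
  then obtain e where e: "n = n' + e" using less_imp_add_positive by blast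
  have de: "e * b = d * a" using nb e by (simp add: algebra_simps)
  then have "b dvd d * a" by (metis dvd_triv_right)
  then have "b dvd d" using assms(1) by (simp add: coprime_commute coprime_dvd_mult_left_iff)
  then obtain t where t: "d = b * t" by blast
  then have "e = a * t" using de assms(3) by (simp add: algebra_simps)
  moreover have "b - 1 \<le> m" using box_values_bound assms by blast
  \<comment> \<open>Since n' < n, the same bound applies with \<open>a\<close> and \<open>b\<close>
    exchanged and the box of m', n' as the first one.\<close>
  moreover have "a - 1 \<le> n'"
    using box_values_bound[of b a n' n m' m] assms \<open>n' < n\<close> by (metis box_values_swap coprime_commute)
  ultimately show thesis using that d e t by blast
qed

lemma diff_dvd_diff_power:
  fixes u v :: "'a::comm_ring_1"
  shows "u - v dvd u ^ n - v ^ n"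
  by (simp add: power_diff_sumr2)

lemma generator_dvd_binomial:
  fixes x y :: "'a::comm_ring_1"
  assumes "coprime a b" and "0 < a" and "0 < b"
    and eq: "box_values a b m n = box_values a b m' n'"
  shows "x ^ (b - 1) * y ^ (a - 1) * (x ^ b - y ^ a) dvd x ^ m * y ^ n - x ^ m' * y ^ n'"
proof -
  let ?g = "x ^ (b - 1) * y ^ (a - 1) * (x ^ b - y ^ a)"
  have less: "?g dvd x ^ m' * y ^ n' - x ^ m * y ^ n"
    if less_eq: "m < m'" "box_values a b m n = box_values a b m' n'" for m n m' n'
  proof -
    obtain t where t: "m' = m + b * t" "n = n' + a * t" "b - 1 \<le> m" "a - 1 \<le> n'"
      using box_values_eqD[OF assms(1-3) less_eq] by blast
    \<comment> \<open>The bounds on \<open>m\<close> and n' make the monomial factor a multiple of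
      x^(b-1) y^(a-1); x^b - y^a divides the difference of \<open>t\<close>-th powers.\<close>
    have "x ^ m' * y ^ n' - x ^ m * y ^ n = x ^ m * y ^ n' * ((x ^ b) ^ t - (y ^ a) ^ t)"
      unfolding t(1,2) by (simp add: power_add power_mult algebra_simps)
    then show ?thesis
      using t(3,4) by (simp add: mult_dvd_mono le_imp_power_dvd diff_dvd_diff_power)
  qed
  consider "m < m'" | "m' < m" | "m = m'" by linarith
  then show ?thesis
  proof cases
    case 1
    show ?thesis using less[OF 1 eq] by (metis dvd_minus_iff minus_diff_eq)
  next
    case 2
    then show ?thesis using less[OF _ eq[symmetric]] by simp
  next
    case 3
    \<comment> \<open>Equal maxima and m = m' force n = n', so the binomial is zero.\<close>
    have "m * a + n * b = m' * a + n' * b"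
      using box_values_le box_values_corner eq by (metis le_antisym)
    then show ?thesis using 3 assms(3) by simp
  qed
qed

theorem theorem9:
  fixes a b k :: nat
  assumes "1 \<le> a" and "a < b" and "coprime a b" and "0 < k"
  shows "(sumset_ideal {0, k * a} {0, k * b} :: 'k::field poly poly set)
           = ideal_gen {varX ^ (b - 1) * varY ^ (a - 1) * (varX ^ b - varY ^ a)}"
proof -
  have pos: "0 < a" "0 < b" using assms by auto
  \<comment> \<open>Expanded, the generator is a binomial whose exponents are those of
    \<open>box_values_generator\<close>.\<close>
  have generator: "(varX ^ (b - 1) * varY ^ (a - 1) * (varX ^ b - varY ^ a) :: 'k poly poly)
      = varX ^ (b - 1 + b) * varY ^ (a - 1) - varX ^ (b - 1) * varY ^ (a - 1 + a)"
    unfolding power_add by (simp add: algebra_simps)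
  show ?thesis
    unfolding sumset_ideal_def fold_sum_plus_eq_iff[OF assms(4)]
  proof (rule ideal_gen_eq_singleton, goal_cases)
    case 1
    show ?case using generator box_values_generator by blast
  next
    case (2 p)
    then show ?case using generator_dvd_binomial[OF assms(3) pos] by blast
  qed
qed

end
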